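(* Let $\mathcal{C}_k$ be a generator of a sparsity model $\mathcal{M}(\mathcal{C}_k)$ of order $k\in\mathbb{N}$ on $[p]$, let $r>0$, and let $f:\mathcal{H}\to\mathbb{R}$ be a twice continuously differentiable function that satisfies the $(\alpha_{\mathcal{C}_k^3},\beta_{\mathcal{C}_k^3},r)$-SMRH condition with respect to the model $\mathcal{M}(\mathcal{C}_k^3)$. Put $\mu_{\mathcal{C}_k^3}:=\alpha_{\mathcal{C}_k^3}/\beta_{\mathcal{C}_k^3}$ and $\eta^\star=2/(\alpha_{\mathcal{C}_k^3}+\beta_{\mathcal{C}_k^3})$. Let $(\theta^{(i)})_{i\ge 0}$ be iterates of the projected gradient descent algorithm with input $\mathcal{C}_k$, $r$ and step sizes $\eta^{(i)}>0$, i.e. $\theta^{(0)}=0$ and $\theta^{(i+1)}=\mathrm{P}_{\mathcal{C}_k,r}\left[\theta^{(i)}-\eta^{(i)}\nabla f(\theta^{(i)})\right]$. Then for any $\overline{\theta}\in\mathcal{H}$ with $\operatorname{supp}(\overline{\theta})\in\mathcal{M}(\mathcal{C}_k)$ and $\|\overline{\theta}\|\le r$, and every $i\ge 0$, $$\left\|\theta^{(i+1)}-\overline{\theta}\right\|\le 2\gamma^{(i)}\left\|\theta^{(i)}-\overline{\theta}\right\|+2\eta^{(i)}\left\|\nabla_{\overline{\mathcal{I}}}f(\overline{\theta})\right\|,$$ where $$\gamma^{(i)}=\frac{\eta^{(i)}}{\eta^\star}\cdot\frac{\mu_{\mathcal{C}_k^3}-1}{\mu_{\mathcal{C}_k^3}+1}+\left|\frac{\eta^{(i)}}{\eta^\star}-1\right|\quad\text{and}\quad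 \overline{\mathcal{I}}=\operatorname{supp}\left(\mathrm{P}_{\mathcal{C}_k^2,r}\left[\nabla f(\overline{\theta})\right]\right).$$
   Context: Setting: $\mathcal{H}$ is a $p$-dimensional real Hilbert space with inner product $\langle\cdot,\cdot\rangle$ and induced norm $\|\cdot\|$; coordinates are taken with respect to a fixed orthonormal basis (so $\mathcal{H}$ may be identified with Euclidean $\mathbb{R}^p$). $[p]=\{1,\dots,p\}$. $\operatorname{supp}(x)$ is the set of indices of non-zero coordinates of $x$. For $\mathcal{I}\subseteq[p]$, $\nabla_{\mathcal{I}}f(\theta)$ is the restriction of the gradient $\nabla f(\theta)$ to the coordinates in $\mathcal{I}$; $\nabla^2 f$ is the Hessian. Sparsity model: let $k$ and $p$ be positive integers (with $k\ll p$, informally; no quantitative condition is meant) and let $\mathcal{C}_k$ be a (non-empty) family of non-empty subsets of $[p]$ of cardinality at most $k$. The sparsity model of order $k$ generated by $\mathcal{C}_k$ is $\mathcal{M}(\mathcal{C}_k)=\bigcup_{\mathcal{S}\in\mathcal{C}_k}2^{\mathcal{S}}$, where $2^{\mathcal{S}}$ is the power set of $\mathcal{S}$. For families of sets, $\mathcal{F}_1\Cup\mathcal{F}_2=\{X_1\cup X_2: X_1\in\mathcal{F}_1, X_2\in\mathcal{F}_2\}$, and $\mathcal{C}_k^2=\mathcal{C}_k\Cup\mathcal{C}_k$, $\mathcal{C}_k^3=\mathcal{C}_k\Cup\mathcal{C}_k\Cup\mathcal{C}_k$; the models $\mathcal{M}(\mathcal{C}_k^2)$, $\mathcal{M}(\mathcal{C}_k^3)$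 are defined by the same formula. Projection: for a generator $\mathcal{C}$ and $r>0$, $\mathrm{P}_{\mathcal{C},r}[\theta_0]$ denotes a solution (any choice of minimizer) of: minimize $\|\theta-\theta_0\|$ over $\theta\in\mathcal{H}$ subject to $\operatorname{supp}(\theta)\in\mathcal{M}(\mathcal{C})$ and $\|\theta\|\le r$. SMRH (Stable Model-Restricted Hessian): for a generator $\mathcal{C}$, let $\alpha_{\mathcal{C}}$ be the smallest and $\beta_{\mathcal{C}}$ the largest positive real numbers such that $$\beta_{\mathcal{C}}\|\Delta\|^2\le\langle\Delta,\nabla^2 f(\theta)\Delta\rangle\le\alpha_{\mathcal{C}}\|\Delta\|^2$$ for all $\Delta,\theta\in\mathcal{H}$ with $\operatorname{supp}(\Delta)\cup\operatorname{supp}(\theta)\in\mathcal{M}(\mathcal{C})$ and $\|\theta\|\le r$. When such positive numbers exist, the twice continuously differentiable function $f$ is said to satisfy $(\alpha_{\mathcal{C}},\beta_{\mathcal{C}},r)$-SMRH with respect to $\mathcal{M}(\mathcal{C})$. *)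

theory Defs
  imports "HOL-Analysis.Analysis"
begin

text \<open>The Hilbert space is \<open>real ^ 'n\<close> with its standard orthonormal basis; the finite index
  type \<open>'n\<close> plays the role of \<open>[p]\<close>, with \<open>p = CARD('n)\<close>.\<close>

definition supp :: "real ^ 'n \<Rightarrow> 'n set" where
  "supp x = {j. x $ j \<noteq> 0}"

text \<open>The restriction to the coordinates in \<open>I\<close> is extended by zero, which does not change
  its norm.\<close>

definition restrict_coords :: "'n set \<Rightarrow> real ^ 'n \<Rightarrow> real ^ 'n" where
  "restrict_coords I x = (\<chi> j. if j \<in> I then x $ j else 0)"

definition grad :: "(real ^ 'n \<Rightarrow> real) \<Rightarrow> real ^ 'n \<Rightarrow> real ^ 'n" where
  "grad f x = (THE g. GDERIV f x :> g)"

definition hessian :: "(real ^ 'n \<Rightarrow> real) \<Rightarrow> real ^ 'n \<Rightarrow> real ^ 'n ^ 'n" where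
  "hessian f x = jacobian (grad f) (at x)"

definition twice_cont_diff :: "(real ^ 'n \<Rightarrow> real) \<Rightarrow> bool" where
  "twice_cont_diff f \<longleftrightarrow>
     (\<forall>x. f differentiable (at x)) \<and>
     (\<forall>x. grad f differentiable (at x)) \<and>
     continuous_on UNIV (hessian f)"

definition generator :: "nat \<Rightarrow> 'n set set \<Rightarrow> bool" where
  "generator k C \<longleftrightarrow> C \<noteq> {} \<and> (\<forall>S\<in>C. S \<noteq> {} \<and> card S \<le> k)"

definition sparsity_model :: "'n set set \<Rightarrow> 'n set set" where
  "sparsity_model C = (\<Union>S\<in>C. Pow S)"

definition family_union :: "'n set set \<Rightarrow> 'n set set \<Rightarrow> 'n set set"  (infixl "\<Cup>" 65) where
  "F1 \<Cup> F2 = {X1 \<union> X2 |X1 X2. X1 \<in> F1 \<and> X2 \<in> F2}"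

text \<open>\<open>is_model_proj C r z \<theta>\<close>: \<open>\<theta>\<close> is one of the (in general not unique) minimizers
  denoted by \<open>P\<^bsub>C,r\<^esub>[z]\<close>.\<close>

definition is_model_proj ::
    "'n set set \<Rightarrow> real \<Rightarrow> real ^ 'n \<Rightarrow> real ^ 'n \<Rightarrow> bool" where
  "is_model_proj C r z \<theta> \<longleftrightarrow>
     is_arg_min (\<lambda>\<theta>'. norm (\<theta>' - z))
       (\<lambda>\<theta>'. supp \<theta>' \<in> sparsity_model C \<and> norm \<theta>' \<le> r) \<theta>"

definition smrh_bounds ::
    "(real ^ 'n \<Rightarrow> real) \<Rightarrow> 'n set set \<Rightarrow> real \<Rightarrow> real \<Rightarrow> real \<Rightarrow> bool" where
  "smrh_bounds f C r \<alpha> \<beta> \<longleftrightarrow>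
     0 < \<alpha> \<and> 0 < \<beta> \<and>
     (\<forall>\<Delta> \<theta>. supp \<Delta> \<union> supp \<theta> \<in> sparsity_model C \<and> norm \<theta> \<le> r \<longrightarrow>
        \<beta> * (norm \<Delta>)\<^sup>2 \<le> \<Delta> \<bullet> (hessian f \<theta> *v \<Delta>) \<and>
        \<Delta> \<bullet> (hessian f \<theta> *v \<Delta>) \<le> \<alpha> * (norm \<Delta>)\<^sup>2)"

definition smrh ::
    "(real ^ 'n \<Rightarrow> real) \<Rightarrow> 'n set set \<Rightarrow> real \<Rightarrow> real \<Rightarrow> real \<Rightarrow> bool" where
  "smrh f C r \<alpha> \<beta> \<longleftrightarrow>
     smrh_bounds f C r \<alpha> \<beta> \<and>
     (\<forall>\<alpha>' \<beta>'. smrh_bounds f C r \<alpha>' \<beta>' \<longrightarrow> \<alpha> \<le> \<alpha>' \<and> \<beta>' \<le> \<beta>)"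

definition pgd_iterates ::
    "'n set set \<Rightarrow> real \<Rightarrow> (real ^ 'n \<Rightarrow> real) \<Rightarrow> (nat \<Rightarrow> real) \<Rightarrow>
      (nat \<Rightarrow> real ^ 'n) \<Rightarrow> bool" where
  "pgd_iterates C r f \<eta> \<theta> \<longleftrightarrow>
     \<theta> 0 = 0 \<and>
     (\<forall>i. is_model_proj C r (\<theta> i - \<eta> i *\<^sub>R grad f (\<theta> i)) (\<theta> (Suc i)))"

end

theory Submission
  imports Defs
begin

text \<open>Let \<open>d = \<theta> (Suc i) - \<theta>bar\<close>, \<open>e = \<theta> i - \<theta>bar\<close> and \<open>\<eta> = \<eta> i\<close>. Comparing the projected point with the
  feasible point \<open>\<theta>bar\<close> gives
  \<open>(norm d)\<^sup>2 \<le> 2 * (d \<bullet> (e - \<eta> *\<^sub>R (grad f (\<theta> i) - grad f \<theta>bar))) - 2 * \<eta> * (d \<bullet> grad f \<theta>bar)\<close>.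
  By the mean value theorem along the segment from \<open>\<theta>bar\<close> to \<open>\<theta> i\<close>, the first inner product is the
  bilinear form of \<open>I - \<eta> H\<close> at \<open>d\<close> and \<open>e\<close>, with \<open>H\<close> the Hessian at a point of the segment. Its quadratic
  form has absolute value at most \<open>\<gamma> i = max (\<eta> * \<alpha> - 1) (1 - \<eta> * \<beta>)\<close> on the unit sphere of the
  relevant coordinate subspace; since \<open>H\<close> is symmetric, polarization transfers this to the bilinear
  form. In the second one only the coordinates in the support of \<open>d\<close> matter, and \<open>Ibar\<close> captures at
  least as much of the gradient at \<open>\<theta>bar\<close> as any other member of the model of \<open>C \<Cup> C\<close>.\<close>

section \<open>Symmetry of the second derivative\<close>

lemma gradient_line_DERIV:
  fixes f :: "'a::real_inner \<Rightarrow> real"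
  assumes "\<And>x. GDERIV f x :> g x"
  shows "((\<lambda>t. f (x + t *\<^sub>R u)) has_real_derivative u \<bullet> g (x + t *\<^sub>R u)) (at t)"
proof -
  have "((\<lambda>t. x + t *\<^sub>R u) has_derivative (\<lambda>h. h *\<^sub>R u)) (at t)"
    by (auto intro!: derivative_eq_intros)
  from has_derivative_compose[OF this assms[unfolded gderiv_def]]
  show ?thesis
    by (simp add: has_field_derivative_def mult_commute_abs)
qed

lemma gradient_inner_line_DERIV:
  fixes g :: "'a::real_inner \<Rightarrow> 'a"
  assumes "\<And>x. (g has_derivative G x) (at x)"
  shows "((\<lambda>t. u \<bullet> g (x + t *\<^sub>R v)) has_real_derivative u \<bullet> G (x + t *\<^sub>R v) v) (at t)"
proof -
  have "((\<lambda>t. x + t *\<^sub>R v) has_derivative (\<lambda>h. h *\<^sub>R v)) (at t)"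
    by (auto intro!: derivative_eq_intros)
  from has_derivative_inner_right[OF has_derivative_compose[OF this assms]]
  have "((\<lambda>t. u \<bullet> g (x + t *\<^sub>R v)) has_derivative
          (\<lambda>h. u \<bullet> G (x + t *\<^sub>R v) (h *\<^sub>R v))) (at t)" .
  moreover have "G y (h *\<^sub>R v) = h *\<^sub>R G y v" for y h
    by (rule linear_cmul[OF has_derivative_linear[OF assms]])
  ultimately show ?thesis
    by (simp add: has_field_derivative_def mult_commute_abs)
qed

text \<open>The mixed second difference is a difference of increments of \<open>f\<close> along two
  parallel segments. One mean value step in direction \<open>u\<close> and one in direction
  \<open>v\<close> turn it into a value of the second derivative.\<close>

lemma second_difference_mvt:
  fixes f :: "'a::real_inner \<Rightarrow> real"
  assumes f: "\<And>x. GDERIV f x :> g x"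
    and g: "\<And>x. (g has_derivative G x) (at x)"
    and "0 < s"
  shows "\<exists>\<xi>\<in>{0..s}. \<exists>\<zeta>\<in>{0..s}.
    f (x + s *\<^sub>R u + s *\<^sub>R v) - f (x + s *\<^sub>R u) - f (x + s *\<^sub>R v) + f x
      = s\<^sup>2 * (u \<bullet> G (x + \<xi> *\<^sub>R u + \<zeta> *\<^sub>R v) v)"
proof -
  define h where "h t = f ((x + s *\<^sub>R v) + t *\<^sub>R u) - f (x + t *\<^sub>R u)" for t
  have "(h has_real_derivative
      u \<bullet> g ((x + s *\<^sub>R v) + t *\<^sub>R u) - u \<bullet> g (x + t *\<^sub>R u)) (at t)" for t
    unfolding h_def by (intro DERIV_diff gradient_line_DERIV f)
  from MVT2[OF \<open>0 < s\<close> this] obtain \<xi> where \<xi>: "0 < \<xi>" "\<xi> < s" and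
    h: "h s - h 0 = s * (u \<bullet> g ((x + s *\<^sub>R v) + \<xi> *\<^sub>R u) - u \<bullet> g (x + \<xi> *\<^sub>R u))"
    by auto
  from MVT2[OF \<open>0 < s\<close> gradient_inner_line_DERIV[OF g, of u "x + \<xi> *\<^sub>R u" v]]
  obtain \<zeta> where \<zeta>: "0 < \<zeta>" "\<zeta> < s" and
    "u \<bullet> g ((x + \<xi> *\<^sub>R u) + s *\<^sub>R v) - u \<bullet> g (x + \<xi> *\<^sub>R u)
      = s * (u \<bullet> G ((x + \<xi> *\<^sub>R u) + \<zeta> *\<^sub>R v) v)"
    by auto
  with h have "h s - h 0 = s\<^sup>2 * (u \<bullet> G (x + \<xi> *\<^sub>R u + \<zeta> *\<^sub>R v) v)"
    by (simp add: power2_eq_square add.assoc add.commute[of "s *\<^sub>R v"])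
  moreover have "h s - h 0
      = f (x + s *\<^sub>R u + s *\<^sub>R v) - f (x + s *\<^sub>R u) - f (x + s *\<^sub>R v) + f x"
    by (simp add: h_def add.assoc add.commute[of "s *\<^sub>R v"])
  ultimately have "f (x + s *\<^sub>R u + s *\<^sub>R v) - f (x + s *\<^sub>R u) - f (x + s *\<^sub>R v) + f x
      = s\<^sup>2 * (u \<bullet> G (x + \<xi> *\<^sub>R u + \<zeta> *\<^sub>R v) v)"
    by (rule trans[OF sym, rotated])
  with \<xi> \<zeta> show ?thesis
    by (intro bexI[of _ \<xi>] bexI[of _ \<zeta>]) simp_all
qed

text \<open>The second difference quotient is unchanged when \<open>u\<close> and \<open>v\<close>
  are swapped, while by continuity it tends to \<open>u \<bullet> G x v\<close>; uniqueness of
  limits identifies the two orders.\<close>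

lemma second_derivative_symmetric:
  fixes f :: "'a::real_inner \<Rightarrow> real"
  assumes f: "\<And>x. GDERIV f x :> g x"
    and g: "\<And>x. (g has_derivative G x) (at x)"
    and cont: "\<And>u v. isCont (\<lambda>y. u \<bullet> G y v) x"
  shows "u \<bullet> G x v = v \<bullet> G x u"
proof -
  define s where "s n = inverse (real (Suc n))" for n
  have s0: "0 < s n" for n by (simp add: s_def)
  have s_lim: "s \<longlonglongrightarrow> 0"
    unfolding s_def by (rule LIMSEQ_inverse_real_of_nat)
  define Q where "Q u v n = (f (x + s n *\<^sub>R u + s n *\<^sub>R v) - f (x + s n *\<^sub>R u)
      - f (x + s n *\<^sub>R v) + f x) / (s n)\<^sup>2" for u v n
  have lim: "Q u v \<longlonglongrightarrow> u \<bullet> G x v" for u v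
  proof -
    have "\<exists>\<xi> \<zeta>. \<xi> \<in> {0..s n} \<and> \<zeta> \<in> {0..s n} \<and>
        Q u v n = u \<bullet> G (x + \<xi> *\<^sub>R u + \<zeta> *\<^sub>R v) v" for n
    proof -
      obtain \<xi> \<zeta> where "\<xi> \<in> {0..s n}" "\<zeta> \<in> {0..s n}" and
        "f (x + s n *\<^sub>R u + s n *\<^sub>R v) - f (x + s n *\<^sub>R u) - f (x + s n *\<^sub>R v) + f x
          = (s n)\<^sup>2 * (u \<bullet> G (x + \<xi> *\<^sub>R u + \<zeta> *\<^sub>R v) v)"
        using second_difference_mvt[OF f g s0] by blast
      moreover from this(3) have "Q u v n = u \<bullet> G (x + \<xi> *\<^sub>R u + \<zeta> *\<^sub>R v) v"
        using s0[of n] by (simp add: Q_def)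
      ultimately show ?thesis by blast
    qed
    then obtain \<xi> \<zeta> where \<xi>\<zeta>: "\<And>n. \<xi> n \<in> {0..s n}" "\<And>n. \<zeta> n \<in> {0..s n}"
      "\<And>n. Q u v n = u \<bullet> G (x + \<xi> n *\<^sub>R u + \<zeta> n *\<^sub>R v) v"
      by metis
    have "\<xi> \<longlonglongrightarrow> 0" "\<zeta> \<longlonglongrightarrow> 0"
      using \<xi>\<zeta>(1,2) by (auto intro!: tendsto_sandwich[OF _ _ tendsto_const s_lim])
    then have "(\<lambda>n. x + \<xi> n *\<^sub>R u + \<zeta> n *\<^sub>R v) \<longlonglongrightarrow> x + 0 *\<^sub>R u + 0 *\<^sub>R v"
      by (intro tendsto_intros)
    then have "(\<lambda>n. u \<bullet> G (x + \<xi> n *\<^sub>R u + \<zeta> n *\<^sub>R v) v) \<longlonglongrightarrow> u \<bullet> G x v"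
      using isCont_tendsto_compose[OF cont] by simp
    then show ?thesis by (simp add: \<xi>\<zeta>(3)[symmetric])
  qed
  have "Q u v = Q v u" by (auto simp: Q_def ac_simps)
  then have "Q v u \<longlonglongrightarrow> u \<bullet> G x v" using lim[of u v] by simp
  then show ?thesis using lim[of v u] by (rule LIMSEQ_unique)
qed

text \<open>\<open>grad\<close> is a definite description, so both existence and uniqueness are due.
  The Riesz representer of the derivative is its adjoint at \<open>1\<close>.\<close>

lemma GDERIV_grad:
  assumes "f differentiable (at x)"
  shows "GDERIV f x :> grad f x"
proof -
  obtain f' where f': "(f has_derivative f') (at x)"
    using assms by (auto simp: differentiable_def)
  then have "f' = (\<lambda>h. h \<bullet> adjoint f' 1)"
    using adjoint_works[OF has_derivative_linear[OF f']] by (auto simp: fun_eq_iff)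
  with f' have g: "GDERIV f x :> adjoint f' 1" by (simp add: gderiv_def)
  have "y = adjoint f' 1" if "GDERIV f x :> y" for y
  proof -
    have "(\<lambda>h. h \<bullet> y) = (\<lambda>h. h \<bullet> adjoint f' 1)"
      using that g unfolding gderiv_def by (rule has_derivative_unique)
    then have "\<forall>h. h \<bullet> y = h \<bullet> adjoint f' 1" by (auto dest: fun_cong)
    then show ?thesis by (simp only: vector_eq_ldot)
  qed
  with g show ?thesis unfolding grad_def by (rule theI)
qed

lemma hessian_has_derivative:
  assumes "twice_cont_diff f"
  shows "(grad f has_derivative (*v) (hessian f x)) (at x)"
  using assms by (simp add: twice_cont_diff_def hessian_def jacobian_works[symmetric])

lemma hessian_symmetric:
  assumes "twice_cont_diff f"
  shows "u \<bullet> (hessian f x *v v) = v \<bullet> (hessian f x *v u)"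
proof (rule second_derivative_symmetric)
  show "GDERIV f y :> grad f y" for y
    using assms by (simp add: twice_cont_diff_def GDERIV_grad)
  show "(grad f has_derivative (*v) (hessian f y)) (at y)" for y
    by (rule hessian_has_derivative[OF assms])
  have "isCont (hessian f) x"
    using assms by (simp add: twice_cont_diff_def continuous_on_eq_continuous_at)
  then show "isCont (\<lambda>y. u \<bullet> (hessian f y *v v)) x" for u v
    unfolding inner_vec_def matrix_vector_mult_def
    by simp
qed

section \<open>Coordinate restriction\<close>

lemma inner_restrict_coords:
  assumes "supp x \<subseteq> S"
  shows "x \<bullet> y = x \<bullet> restrict_coords S y"
  using assms by (auto simp: inner_vec_def restrict_coords_def supp_def intro!: sum.cong)

lemma inner_restrict_coords_self: "restrict_coords S y \<bullet> y = (norm (restrict_coords S y))\<^sup>2"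
  unfolding power2_norm_eq_inner
  by (rule inner_restrict_coords) (auto simp: supp_def restrict_coords_def)

lemma inner_le_norm_restrict_coords:
  assumes "supp x \<subseteq> S"
  shows "x \<bullet> y \<le> norm x * norm (restrict_coords S y)"
  by (metis assms inner_restrict_coords norm_cauchy_schwarz)

lemma supp_diff_subset: "supp (x - y) \<subseteq> supp x \<union> supp y"
  and supp_scaleR_subset: "supp (c *\<^sub>R x) \<subseteq> supp x"
  and supp_restrict_coords_subset: "supp (restrict_coords S x) \<subseteq> S"
  by (auto simp: supp_def restrict_coords_def)

lemma sparsity_model_downward:
  assumes "S \<in> sparsity_model C" "T \<subseteq> S"
  shows "T \<in> sparsity_model C"
  using assms by (auto simp: sparsity_model_def)

lemma Un_in_sparsity_model:
  assumes "S \<in> sparsity_model C" "T \<in> sparsity_model C'"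
  shows "S \<union> T \<in> sparsity_model (C \<Cup> C')"
  using assms unfolding sparsity_model_def family_union_def by blast

section \<open>Model projections\<close>

lemma norm_diff_le_iff_inner:
  fixes x y z :: "'a::real_inner"
  shows "norm (x - z) \<le> norm (y - z) \<longleftrightarrow>
    (norm x)\<^sup>2 - 2 * (x \<bullet> z) \<le> (norm y)\<^sup>2 - 2 * (y \<bullet> z)"
proof -
  have "norm (x - z) \<le> norm (y - z) \<longleftrightarrow> (norm (x - z))\<^sup>2 \<le> (norm (y - z))\<^sup>2"
    using abs_le_square_iff[of "norm (x - z)" "norm (y - z)"] by simp
  then show ?thesis
    by (simp add: power2_norm_eq_inner inner_diff inner_commute)
qed

lemma is_model_projD:
  assumes "is_model_proj C r z x"
  shows "supp x \<in> sparsity_model C" "norm x \<le> r"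
    "\<And>y. supp y \<in> sparsity_model C \<Longrightarrow> norm y \<le> r \<Longrightarrow> norm (x - z) \<le> norm (y - z)"
  using assms by (auto simp: is_model_proj_def is_arg_min_def not_less)

text \<open>Over vectors of norm \<open>s\<close> supported in \<open>T\<close>, the distance to \<open>v\<close> is least for a multiple of
  the restriction of \<open>v\<close> to \<open>T\<close>, and the minimum decreases in the norm of that restriction.\<close>

lemma norm_restrict_coords_le_model_proj:
  assumes proj: "is_model_proj C r v g" and "r > 0" and T: "T \<in> sparsity_model C"
  shows "norm (restrict_coords T v) \<le> norm (restrict_coords (supp g) v)"
proof (rule ccontr)
  define a where "a = norm (restrict_coords T v)"
  define b where "b = norm (restrict_coords (supp g) v)"
  \<comment> \<open>On norms in \<open>{0..r}\<close>, the value
    \<open>t\<^sup>2 - 2 * t * a\<close> is least at \<open>t = \<rho>\<close>; \<open>w\<close> is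
    the feasible competitor to \<open>g\<close> attaining it.\<close>
  define \<rho> where "\<rho> = min a r"
  define w where "w = (\<rho> / a) *\<^sub>R restrict_coords T v"
  define s where "s = norm g"
  assume "\<not> ?thesis"
  then have "b < a" by (simp add: a_def b_def)
  moreover have "0 \<le> b" by (simp add: b_def)
  ultimately have "0 < a" by simp
  with \<open>r > 0\<close> have "0 < \<rho>" "\<rho> \<le> a" "\<rho> \<le> r" by (auto simp: \<rho>_def)
  have norm_w: "norm w = \<rho>"
    using \<open>0 < a\<close> \<open>0 < \<rho>\<close> by (simp add: w_def a_def)
  have inner_w: "w \<bullet> v = \<rho> * a"
    using \<open>0 < a\<close> by (simp add: w_def inner_restrict_coords_self power2_eq_square a_def)
  have "supp w \<in> sparsity_model C"
    using T supp_scaleR_subset supp_restrict_coords_subset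
    unfolding w_def by (meson order_trans sparsity_model_downward)
  with is_model_projD(3)[OF proj] norm_w \<open>\<rho> \<le> r\<close>
  have "s\<^sup>2 - 2 * (g \<bullet> v) \<le> \<rho>\<^sup>2 - 2 * (\<rho> * a)"
    using norm_diff_le_iff_inner[of g v w] by (simp add: s_def inner_w)
  moreover have "g \<bullet> v \<le> s * b"
    unfolding s_def b_def by (rule inner_le_norm_restrict_coords) simp
  ultimately have le: "s\<^sup>2 - 2 * (s * b) \<le> \<rho>\<^sup>2 - 2 * (\<rho> * a)" by linarith
  have "0 \<le> s" "s \<le> r" using is_model_projD(2)[OF proj] by (auto simp: s_def)
  show False
  \<comment> \<open>For \<open>s = 0\<close> the strict gain from \<open>b < a\<close> is lost, but
    then the left side of \<open>le\<close> is zero and the right side negative. Otherwise adding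
    \<open>a\<^sup>2\<close> completes both squares, and \<open>\<rho>\<close> is at least as close
    to \<open>a\<close> as \<open>s\<close> is.\<close>
  proof (cases "s = 0")
    case True
    have "\<rho> * \<rho> < 2 * (\<rho> * a)"
      using \<open>0 < \<rho>\<close> \<open>\<rho> \<le> a\<close> by (smt (verit) mult_left_mono mult_pos_pos)
    with le True show False by (simp add: power2_eq_square)
  next
    case False
    with \<open>0 \<le> s\<close> \<open>b < a\<close> have "s * b < s * a" by simp
    with le have "(s - a)\<^sup>2 < (\<rho> - a)\<^sup>2" by (simp add: power2_diff)
    moreover have "\<bar>\<rho> - a\<bar> \<le> \<bar>s - a\<bar>"
      using \<open>s \<le> r\<close> by (auto simp: \<rho>_def)
    ultimately show False by (simp add: abs_le_square_iff)
  qed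
qed

text \<open>The constraint set is not convex, so the obtuse-angle inequality for projections is
  unavailable; plain minimality costs the factor 2.\<close>

lemma model_proj_inner:
  assumes "is_model_proj C r z x" "supp y \<in> sparsity_model C" "norm y \<le> r"
  shows "(norm (x - y))\<^sup>2 \<le> 2 * ((x - y) \<bullet> (z - y))"
proof -
  have "(norm (x - z))\<^sup>2 \<le> (norm (y - z))\<^sup>2"
    using is_model_projD(3)[OF assms] by (simp add: power_mono)
  then show ?thesis
    by (simp add: power2_norm_eq_inner inner_diff inner_commute algebra_simps)
qed

section \<open>The gradient step\<close>

text \<open>Polarization bounds the form by an arithmetic mean of squared norms. Rescaling both
  vectors to the common norm \<open>norm x * norm y\<close> makes that mean a product.\<close>

lemma symmetric_form_bound:
  fixes L :: "'a::real_inner \<Rightarrow> 'a"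
  assumes "linear L" "subspace V" "x \<in> V" "y \<in> V"
    and sym: "\<And>x y. x \<bullet> L y = y \<bullet> L x"
    and bound: "\<And>z. z \<in> V \<Longrightarrow> \<bar>z \<bullet> L z\<bar> \<le> M * (norm z)\<^sup>2"
  shows "x \<bullet> L y \<le> M * norm x * norm y"
proof -
  interpret L: linear L by fact
  have polar: "2 * (x \<bullet> L y) \<le> M * ((norm x)\<^sup>2 + (norm y)\<^sup>2)" if "x \<in> V" "y \<in> V" for x y
  proof -
    have "4 * (x \<bullet> L y) = (x + y) \<bullet> L (x + y) - (x - y) \<bullet> L (x - y)"
      using sym[of x y] by (simp add: L.add L.diff inner_add inner_diff)
    also have "\<dots> \<le> M * (norm (x + y))\<^sup>2 + M * (norm (x - y))\<^sup>2"
      using bound[of "x + y"] bound[of "x - y"] that \<open>subspace V\<close>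
      by (simp add: subspace_add subspace_diff)
    also have "\<dots> = 2 * (M * ((norm x)\<^sup>2 + (norm y)\<^sup>2))"
      by (simp add: power2_norm_eq_inner inner_add inner_diff inner_commute algebra_simps)
    finally show ?thesis by simp
  qed
  show ?thesis
  proof (cases "x = 0 \<or> y = 0")
    case True
    then show ?thesis by (auto simp: L.zero)
  next
    case False
    then have pos: "0 < norm x * norm y" by simp
    have "2 * ((norm y *\<^sub>R x) \<bullet> L (norm x *\<^sub>R y))
        \<le> M * ((norm (norm y *\<^sub>R x))\<^sup>2 + (norm (norm x *\<^sub>R y))\<^sup>2)"
      using assms by (intro polar subspace_scale)
    then have "(norm x * norm y) * (x \<bullet> L y) \<le> (norm x * norm y) * (M * norm x * norm y)"
      by (simp add: L.scale power2_eq_square algebra_simps)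
    with pos show ?thesis by (simp only: mult_le_cancel_left_pos)
  qed
qed

lemma subspace_supp_subset: "subspace {x. supp x \<subseteq> T}"
  unfolding subspace_def by (auto simp: supp_def subset_iff) (metis add.right_neutral)

lemma gradient_step_inner_le:
  assumes f: "twice_cont_diff f" and smrh: "smrh_bounds f C r \<alpha> \<beta>"
    and T: "supp x \<union> supp y \<union> supp d \<in> sparsity_model C"
    and "norm x \<le> r" "norm y \<le> r" "0 \<le> \<eta>"
    and c: "\<eta> * \<alpha> - 1 \<le> c" "1 - \<eta> * \<beta> \<le> c"
  shows "d \<bullet> ((x - y) - \<eta> *\<^sub>R (grad f x - grad f y)) \<le> c * norm d * norm (x - y)"
proof -
  define T where "T = supp x \<union> supp y \<union> supp d"
  define e where "e = x - y"
  \<comment> \<open>Pairing with the fixed \<open>d\<close> makes the gradient difference scalar, so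
    a single intermediate point serves; \<open>\<phi> 1 - \<phi> 0\<close> is the inner product to
    be bounded.\<close>
  define \<phi> where "\<phi> t = t * (d \<bullet> e) - \<eta> * (d \<bullet> grad f (y + t *\<^sub>R e))" for t
  have "(\<phi> has_real_derivative d \<bullet> e - \<eta> * (d \<bullet> (hessian f (y + t *\<^sub>R e) *v e))) (at t)" for t
    unfolding \<phi>_def
    by (intro DERIV_diff DERIV_cmult gradient_inner_line_DERIV hessian_has_derivative f)
      (auto intro!: derivative_eq_intros)
  from MVT2[OF zero_less_one this] obtain t where t: "0 < t" "t < 1" and
    mvt: "\<phi> 1 - \<phi> 0 = d \<bullet> e - \<eta> * (d \<bullet> (hessian f (y + t *\<^sub>R e) *v e))"
    by auto
  define H where "H = hessian f (y + t *\<^sub>R e)"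
  define L where "L h = h - \<eta> *\<^sub>R (H *v h)" for h
  \<comment> \<open>The Hessian bounds hold only at points of norm at most \<open>r\<close> whose
    support, joined with that of the direction, lies in the model. Convexity of the ball gives the
    first; the common set \<open>T\<close> gives the second.\<close>
  have "y + t *\<^sub>R e = (1 - t) *\<^sub>R y + t *\<^sub>R x" by (simp add: e_def algebra_simps)
  also have "norm \<dots> \<le> r"
    using convexD[OF convex_cball, of y 0 r x "1 - t" t] t assms by (simp add: mem_cball_0)
  finally have norm_pt: "norm (y + t *\<^sub>R e) \<le> r" .
  have supp_pt: "supp (y + t *\<^sub>R e) \<subseteq> T"
    by (auto simp: supp_def e_def T_def)
  have "d \<bullet> L e \<le> c * norm d * norm e"
  proof (rule symmetric_form_bound[OF _ subspace_supp_subset[of T]])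
    show "linear L"
      unfolding L_def by (intro linear_compose_sub linear_ident linear_compose_scale_right matrix_vector_mul_linear)
    show "d \<in> {z. supp z \<subseteq> T}" "e \<in> {z. supp z \<subseteq> T}"
      by (auto simp: T_def e_def supp_def)
    show "u \<bullet> L v = v \<bullet> L u" for u v
      using hessian_symmetric[OF f] by (simp add: L_def H_def inner_diff inner_commute)
    fix z assume "z \<in> {z. supp z \<subseteq> T}"
    with supp_pt have "supp z \<union> supp (y + t *\<^sub>R e) \<in> sparsity_model C"
      by (intro sparsity_model_downward[OF assms(3)]) (auto simp: T_def)
    with smrh norm_pt have "\<beta> * (norm z)\<^sup>2 \<le> z \<bullet> (H *v z)" "z \<bullet> (H *v z) \<le> \<alpha> * (norm z)\<^sup>2"
      by (auto simp: smrh_bounds_def H_def)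
    from this[THEN mult_left_mono[OF _ \<open>0 \<le> \<eta>\<close>]]
    have "(1 - \<eta> * \<alpha>) * (norm z)\<^sup>2 \<le> z \<bullet> L z" "z \<bullet> L z \<le> (1 - \<eta> * \<beta>) * (norm z)\<^sup>2"
      by (simp_all add: L_def inner_diff power2_norm_eq_inner algebra_simps)
    with c[THEN mult_right_mono[where c = "(norm z)\<^sup>2"]]
    show "\<bar>z \<bullet> L z\<bar> \<le> c * (norm z)\<^sup>2"
      by (simp add: algebra_simps abs_le_iff)
  qed
  moreover have "d \<bullet> L e = \<phi> 1 - \<phi> 0"
    by (simp add: mvt L_def H_def inner_diff)
  ultimately show ?thesis
    by (simp add: \<phi>_def e_def inner_diff algebra_simps)
qed

section \<open>Recursion for the distance of the iterates to \<open>\<theta>bar\<close>\<close>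

theorem theorem1:
  fixes f :: "real ^ 'n \<Rightarrow> real"
    and C :: "'n set set"
    and k :: nat
    and r \<alpha> \<beta> \<mu> \<eta>_star :: real
    and \<eta> \<gamma> :: "nat \<Rightarrow> real"
    and \<theta> :: "nat \<Rightarrow> real ^ 'n"
    and \<theta>bar g :: "real ^ 'n"
    and Ibar :: "'n set"
  assumes "k > 0"
    and "generator k C"
    and "r > 0"
    and "twice_cont_diff f"
    and "smrh f (C \<Cup> C \<Cup> C) r \<alpha> \<beta>"
    and "\<mu> = \<alpha> / \<beta>"
    and "\<eta>_star = 2 / (\<alpha> + \<beta>)"
    and "\<And>i. \<eta> i > 0"
    and "pgd_iterates C r f \<eta> \<theta>"
    and "supp \<theta>bar \<in> sparsity_model C"
    and "norm \<theta>bar \<le> r"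
    and "\<And>i. \<gamma> i = \<eta> i / \<eta>_star * ((\<mu> - 1) / (\<mu> + 1)) + \<bar>\<eta> i / \<eta>_star - 1\<bar>"
    and "is_model_proj (C \<Cup> C) r (grad f \<theta>bar) g"
    and "Ibar = supp g"
  shows "\<forall>i. norm (\<theta> (Suc i) - \<theta>bar) \<le>
           2 * \<gamma> i * norm (\<theta> i - \<theta>bar) + 2 * \<eta> i * norm (restrict_coords Ibar (grad f \<theta>bar))"
proof
  fix i
  define d where "d = \<theta> (Suc i) - \<theta>bar"
  define e where "e = \<theta> i - \<theta>bar"
  define G where "G = norm (restrict_coords Ibar (grad f \<theta>bar))"
  note bounds = assms(5)[unfolded smrh_def, THEN conjunct1]
  have "0 < \<alpha>" "0 < \<beta>" using bounds by (auto simp: smrh_bounds_def)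
  have "\<eta> i > 0" by fact
  have proj: "is_model_proj C r (\<theta> j - \<eta> j *\<^sub>R grad f (\<theta> j)) (\<theta> (Suc j))" for j
    using assms(9) by (simp add: pgd_iterates_def)
  have "supp (0 :: real ^ 'n) \<in> sparsity_model C"
    using \<open>generator k C\<close> by (auto simp: generator_def sparsity_model_def supp_def)
  then have feasible: "supp (\<theta> j) \<in> sparsity_model C \<and> norm (\<theta> j) \<le> r" for j
    using assms(9) \<open>r > 0\<close> is_model_projD(1,2)[OF proj]
    by (cases j) (auto simp: pgd_iterates_def)
  have "(\<mu> - 1) / (\<mu> + 1) = (\<alpha> - \<beta>) / (\<alpha> + \<beta>)"
    using \<open>0 < \<alpha>\<close> \<open>0 < \<beta>\<close> by (simp add: assms(6) divide_simps)
  moreover have step_ratio: "\<eta> i / \<eta>_star = \<eta> i * (\<alpha> + \<beta>) / 2" by (simp add: assms(7))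
  ultimately have "\<eta> i / \<eta>_star * ((\<mu> - 1) / (\<mu> + 1))
      = \<eta> i * (\<alpha> + \<beta>) / 2 * ((\<alpha> - \<beta>) / (\<alpha> + \<beta>))"
    by (simp only:)
  also have "\<dots> = \<eta> i * (\<alpha> - \<beta>) / 2"
  proof -
    have "x * s / 2 * (t / s) = x * t / 2" if "s \<noteq> 0" for x s t :: real
      using that by simp
    then show ?thesis using \<open>0 < \<alpha>\<close> \<open>0 < \<beta>\<close> by (metis add_pos_pos less_irrefl)
  qed
  \<comment> \<open>Resolving the absolute value with either sign gives exactly
    \<open>\<eta> i * \<alpha> - 1\<close> and \<open>1 - \<eta> i * \<beta>\<close>.\<close>
  finally have "\<gamma> i = \<eta> i * (\<alpha> - \<beta>) / 2 + \<bar>\<eta> i * (\<alpha> + \<beta>) / 2 - 1\<bar>"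
    unfolding assms(12) step_ratio by simp
  then have \<gamma>: "\<eta> i * \<alpha> - 1 \<le> \<gamma> i" "1 - \<eta> i * \<beta> \<le> \<gamma> i"
    by (simp_all add: field_simps abs_if split: if_splits)
  \<comment> \<open>The supports of \<open>d\<close> and of the segment share that of
    \<open>\<theta>bar\<close>, so three members of the model of \<open>C\<close> suffice.\<close>
  have supp3: "supp (\<theta> i) \<union> supp \<theta>bar \<union> supp d \<in> sparsity_model (C \<Cup> C \<Cup> C)"
  proof (rule sparsity_model_downward)
    show "supp (\<theta> i) \<union> supp \<theta>bar \<union> supp (\<theta> (Suc i)) \<in> sparsity_model (C \<Cup> C \<Cup> C)"
      using feasible assms(10) by (intro Un_in_sparsity_model) auto
    show "supp (\<theta> i) \<union> supp \<theta>bar \<union> supp d \<subseteq> supp (\<theta> i) \<union> supp \<theta>bar \<union> supp (\<theta> (Suc i))"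
      using supp_diff_subset[of "\<theta> (Suc i)" \<theta>bar] by (auto simp: d_def)
  qed
  have step: "d \<bullet> (e - \<eta> i *\<^sub>R (grad f (\<theta> i) - grad f \<theta>bar)) \<le> \<gamma> i * norm d * norm e"
    unfolding e_def using feasible assms(11) \<open>\<eta> i > 0\<close>
    by (intro gradient_step_inner_le[OF assms(4) bounds supp3] \<gamma>) auto
  have "supp (\<theta> (Suc i)) \<union> supp \<theta>bar \<in> sparsity_model (C \<Cup> C)"
    using feasible assms(10) by (intro Un_in_sparsity_model) auto
  then have supp2: "supp d \<in> sparsity_model (C \<Cup> C)"
    unfolding d_def by (rule sparsity_model_downward[OF _ supp_diff_subset])
  have "- d \<bullet> grad f \<theta>bar \<le> norm d * norm (restrict_coords (supp d) (grad f \<theta>bar))"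
    using inner_le_norm_restrict_coords[of "- d" "supp d"] by (simp add: supp_def)
  also have "\<dots> \<le> norm d * G"
    using norm_restrict_coords_le_model_proj[OF assms(13) \<open>r > 0\<close> supp2]
    by (simp add: G_def assms(14) mult_left_mono)
  finally have noise: "\<eta> i * (- d \<bullet> grad f \<theta>bar) \<le> \<eta> i * (norm d * G)"
    by (rule mult_left_mono) (use \<open>\<eta> i > 0\<close> in simp)
  have "(norm d)\<^sup>2 \<le> 2 * (d \<bullet> (\<theta> i - \<eta> i *\<^sub>R grad f (\<theta> i) - \<theta>bar))"
    unfolding d_def by (rule model_proj_inner[OF proj assms(10,11)])
  \<comment> \<open>Adding and subtracting \<open>grad f \<theta>bar\<close> separates the
    contracting part from the noise at \<open>\<theta>bar\<close>.\<close>
  also have "\<dots> = 2 * (d \<bullet> (e - \<eta> i *\<^sub>R (grad f (\<theta> i) - grad f \<theta>bar)))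
      + 2 * (\<eta> i * (- d \<bullet> grad f \<theta>bar))"
    by (simp add: e_def inner_diff algebra_simps)
  also have "\<dots> \<le> norm d * (2 * \<gamma> i * norm e + 2 * \<eta> i * G)"
    using step noise by (simp add: algebra_simps)
  finally have "norm d * norm d \<le> norm d * (2 * \<gamma> i * norm e + 2 * \<eta> i * G)"
    by (simp add: power2_eq_square)
  \<comment> \<open>Cancelling \<open>norm d\<close> fails when it is zero, where the claim is that
    the right side is nonnegative. Testing the Hessian bounds at the origin with a coordinate vector
    from a nonempty generator set gives \<open>\<beta> \<le> \<alpha>\<close>; the two bounds in
    \<open>\<gamma>\<close> then add up to \<open>0 \<le> 2 * \<gamma> i\<close>.\<close>
  moreover have "0 \<le> 2 * \<gamma> i * norm e + 2 * \<eta> i * G"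
  proof -
    obtain S j where "S \<in> C" and "j \<in> S"
      using \<open>generator k C\<close> unfolding generator_def by blast
    then have "S \<in> sparsity_model C" by (auto simp: sparsity_model_def)
    then have "S \<union> S \<union> S \<in> sparsity_model (C \<Cup> C \<Cup> C)"
      by (intro Un_in_sparsity_model)
    then have "supp (axis j 1 :: real ^ 'n) \<union> supp (0 :: real ^ 'n) \<in> sparsity_model (C \<Cup> C \<Cup> C)"
      using \<open>j \<in> S\<close> by (elim sparsity_model_downward) (auto simp: supp_def axis_def)
    then have "\<beta> \<le> \<alpha>"
      using bounds \<open>r > 0\<close> unfolding smrh_bounds_def by (force simp: norm_axis_1)
    with \<gamma> \<open>\<eta> i > 0\<close> have "0 \<le> \<gamma> i"
      by (smt (verit) mult_left_mono)
    then show ?thesis using \<open>\<eta> i > 0\<close> by (simp add: G_def)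
  qed
  ultimately show "norm (\<theta> (Suc i) - \<theta>bar) \<le>
      2 * \<gamma> i * norm (\<theta> i - \<theta>bar) + 2 * \<eta> i * norm (restrict_coords Ibar (grad f \<theta>bar))"
    unfolding d_def[symmetric] e_def[symmetric] G_def[symmetric]
    by (cases "norm d = 0") (simp_all add: mult_le_cancel_left)
qed

end
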